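(* The vector space $\overline{\mathfrak{rc}_0}$ is a Lie algebra with the Ihara bracket $$\{\psi_1,\psi_2\}=d_{\psi_2}(\psi_1)-d_{\psi_1}(\psi_2)-[\psi_1,\psi_2];$$ in particular $\{\psi_1,\psi_2\}\in\overline{\mathfrak{rc}_0}$ for all $\psi_1,\psi_2\in\overline{\mathfrak{rc}_0}$.
   Context: Let $k$ be a field of characteristic $0$, $A=k\langle\langle x_0,x_1\rangle\rangle$ the algebra of noncommutative formal power series with concatenation product, and $\mathfrak{fr}_k(x_0,x_1)\subset A$ the Lie algebra of Lie series. $c_w(\varphi)$ is the coefficient of the word $w$ in $\varphi$, and $\varepsilon$ is the constant-term map. For $x\in A$, the maps $d^R_i,d^L_i$ are defined by $x=\varepsilon(x)+\sum_{i=0}^1x_id^R_i(x)=\varepsilon(x)+\sum_{i=0}^1d^L_i(x)x_i$. For $\psi\in\mathfrak{fr}_k(x_0,x_1)$, $d_\psi$ is the (continuous) derivation of $A$ with $d_\psi(x_0)=0$, $d_\psi(x_1)=[x_1,\psi]$. The reduced coaction $\mu:A\to A$ is the (continuous) linear map with $\mu(1)=\mu(x_0)=\mu(x_1)=0$ and $\mu(k_1\cdots k_n)=\sum_{i=1}^{n-1}k_1\cdots k_{i-1}(k_i\odot k_{i+1})k_{i+2}\cdots k_n$ for letters $k_i\in\{x_0,x_1\}$, where $x_i\odot x_j=\delta_{ij}x_i$. For a Lie series $\eta$ with $c_{x_0}(\eta)=c_{x_1}(\eta)=0$ put $r_\eta(x)=\sum_{l\ge0}c_{x_0^{l+1}x_1}(\eta)\,x^{l+1}$.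 $\overline{\mathfrak{rc}_0}$ is the vector space of all $\eta\in\mathfrak{fr}_k(x_0,x_1)$ with $c_{x_0}(\eta)=c_{x_1}(\eta)=0$ that are skew-symmetric, $\eta(x_0,x_1)=-\eta(x_1,x_0)$, and satisfy the reduced coaction equation $$d^R_1(\eta)+\mu(\eta)+d^L_0(\eta)=-r_\eta(x_1)+r_\eta(x_0).$$ *)

theory Defs
  imports Complex_Main "HOL-Library.Groups_Big_Fun"
begin

section \<open>Noncommutative formal power series in two letters\<close>

datatype letter = X0 | X1

typedef 'k ncps = "UNIV :: (letter list \<Rightarrow> 'k) set"
  morphisms nc_coeff Abs_ncps ..

notation nc_coeff (infixl "$$" 75)

lemma ncps_eq_iff: "f = g \<longleftrightarrow> (\<forall>w. f $$ w = g $$ w)"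
  by (metis nc_coeff_inject ext)

lemma ncps_eqI: "(\<And>w. f $$ w = g $$ w) \<Longrightarrow> f = g"
  by (simp add: ncps_eq_iff)

lemma coeff_Abs_ncps [simp]: "Abs_ncps c $$ w = c w"
  by (simp add: Abs_ncps_inverse)

instantiation ncps :: (ring_1) ring_1
begin

definition "0 = Abs_ncps (\<lambda>w. 0)"
definition "1 = Abs_ncps (\<lambda>w. if w = [] then 1 else 0)"
definition "f + g = Abs_ncps (\<lambda>w. f $$ w + g $$ w)"
definition "f - g = Abs_ncps (\<lambda>w. f $$ w - g $$ w)"
definition "- f = Abs_ncps (\<lambda>w. - (f $$ w))"

text \<open>Concatenation product: sum over all factorisations of the word.\<close>
definition "f * g = Abs_ncps (\<lambda>w. \<Sum>i\<le>length w. f $$ take i w * g $$ drop i w)"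

lemma mult_assoc_sum_aux:
  fixes F :: "nat \<Rightarrow> nat \<Rightarrow> 'b::comm_monoid_add"
  shows "(\<Sum>j\<le>k. \<Sum>i\<le>j. F i (j - i)) = (\<Sum>j\<le>k. \<Sum>i\<le>k - j. F j i)"
  by (induct k) (simp_all add: Suc_diff_le sum.distrib add.assoc atMost_Suc)

instance
proof
  fix f g h :: "'a ncps"
  show "f * g * h = f * (g * h)"
  proof (rule ncps_eqI)
    fix w
    let ?F = "\<lambda>i l. f $$ take i w * g $$ take l (drop i w) * h $$ drop (i + l) w"
    have "(f * g * h) $$ w = (\<Sum>j\<le>length w. \<Sum>i\<le>j. ?F i (j - i))"
      by (auto simp: times_ncps_def sum_distrib_right min_def drop_take intro!: sum.cong)
    also have "\<dots> = (\<Sum>j\<le>length w. \<Sum>i\<le>length w - j. ?F j i)"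
      by (rule mult_assoc_sum_aux)
    also have "\<dots> = (f * (g * h)) $$ w"
      by (auto simp: times_ncps_def sum_distrib_left mult.assoc add.commute intro!: sum.cong)
    finally show "(f * g * h) $$ w = (f * (g * h)) $$ w" .
  qed
  show "1 * f = f"
  proof (rule ncps_eqI)
    fix w
    have "(1 * f) $$ w = (\<Sum>i\<le>length w. if i = 0 then f $$ w else 0)"
      unfolding times_ncps_def one_ncps_def coeff_Abs_ncps by (rule sum.cong) auto
    then show "(1 * f) $$ w = f $$ w" by simp
  qed
  show "f * 1 = f"
  proof (rule ncps_eqI)
    fix w
    have "(f * 1) $$ w = (\<Sum>i\<le>length w. if i = length w then f $$ w else 0)"
      unfolding times_ncps_def one_ncps_def coeff_Abs_ncps by (rule sum.cong) auto
    then show "(f * 1) $$ w = f $$ w" by simp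
  qed
  show "(0::'a ncps) \<noteq> 1"
    by (auto simp: ncps_eq_iff zero_ncps_def one_ncps_def)
qed (auto simp: ncps_eq_iff zero_ncps_def plus_ncps_def minus_ncps_def uminus_ncps_def
    times_ncps_def algebra_simps sum.distrib)

end

lemma coeff_simps [simp]:
  "0 $$ w = 0" "(f + g) $$ w = f $$ w + g $$ w"
  "(f - g) $$ w = f $$ w - g $$ w" "(- f) $$ w = - (f $$ w)"
  by (simp_all add: zero_ncps_def plus_ncps_def minus_ncps_def uminus_ncps_def)

lemma coeff_one: "1 $$ w = (if w = [] then 1 else 0)"
  by (simp add: one_ncps_def)

lemma coeff_mult: "(f * g) $$ w = (\<Sum>i\<le>length w. f $$ take i w * g $$ drop i w)"
  by (simp add: times_ncps_def)

lemma coeff_sum: "(\<Sum>i\<in>I. f i) $$ w = (\<Sum>i\<in>I. f i $$ w)"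
  by (induct I rule: infinite_finite_induct) simp_all

definition nc_scale :: "'k::field \<Rightarrow> 'k ncps \<Rightarrow> 'k ncps" where
  "nc_scale c f = Abs_ncps (\<lambda>w. c * f $$ w)"

lemma coeff_scale [simp]: "nc_scale c f $$ w = c * f $$ w"
  by (simp add: nc_scale_def)

interpretation ncps: vector_space nc_scale
  by unfold_locales (simp_all add: ncps_eq_iff algebra_simps)

lemma nc_scale_mult_left [simp]: "nc_scale c f * g = nc_scale c (f * g)"
  by (simp add: ncps_eq_iff coeff_mult sum_distrib_left mult.assoc)

lemma nc_scale_mult_right [simp]: "f * nc_scale c g = nc_scale c (f * g)"
  by (simp add: ncps_eq_iff coeff_mult sum_distrib_left mult.left_commute)

definition nc_word :: "letter list \<Rightarrow> 'k::field ncps" where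
  "nc_word w = Abs_ncps (\<lambda>v. if v = w then 1 else 0)"

definition nc_var :: "letter \<Rightarrow> 'k::field ncps" where
  "nc_var i = nc_word [i]"

lemma coeff_word: "nc_word w $$ v = (if v = w then 1 else 0)"
  by (simp add: nc_word_def)

lemma nc_word_Nil: "nc_word [] = 1"
  by (simp add: ncps_eq_iff coeff_word coeff_one)

lemma nc_word_append: "(nc_word (u @ v) :: 'k::field ncps) = nc_word u * nc_word v"
proof (rule ncps_eqI)
  fix w
  have eq: "take i w = u \<and> drop i w = v \<longleftrightarrow> i = length u \<and> w = u @ v"
    if "i \<le> length w" for i
    using that by (metis append_eq_conv_conj append_take_drop_id length_take min.absorb2)
  have "(nc_word u * nc_word v :: 'k ncps) $$ w =
      (\<Sum>i\<le>length w. if i = length u \<and> w = u @ v then 1 else 0)"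
    unfolding coeff_mult coeff_word
    by (rule sum.cong[OF refl]) (use eq in auto)
  then show "nc_word (u @ v) $$ w = (nc_word u * nc_word v :: 'k ncps) $$ w"
    by (auto simp: coeff_word if_distrib cong: if_cong)
qed

lemma nc_word_Cons: "nc_word (i # w) = nc_var i * nc_word w"
  using nc_word_append[of "[i]" w] by (simp add: nc_var_def)

text \<open>Commutator bracket.\<close>
definition nc_br :: "'k::field ncps \<Rightarrow> 'k ncps \<Rightarrow> 'k ncps" where
  "nc_br f g = f * g - g * f"

section \<open>Infinite sums and continuous linear maps\<close>

text \<open>
  Coefficientwise sum of a family; meaningful when the family is locally finite, i.e.
  when every word has a nonzero coefficient in only finitely many members.
\<close>
definition nc_sum :: "('i \<Rightarrow> 'k::field ncps) \<Rightarrow> 'k ncps" where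
  "nc_sum F = Abs_ncps (\<lambda>v. Sum_any (\<lambda>i. F i $$ v))"

text \<open>
  Continuous linear extension of a map given on words; see \<open>nc_ext_unique\<close>.
\<close>
definition nc_ext :: "(letter list \<Rightarrow> 'k::field ncps) \<Rightarrow> 'k ncps \<Rightarrow> 'k ncps" where
  "nc_ext F f = nc_sum (\<lambda>w. nc_scale (f $$ w) (F w))"

definition nc_locally_finite :: "(letter list \<Rightarrow> 'k::field ncps) \<Rightarrow> bool" where
  "nc_locally_finite F \<longleftrightarrow> (\<forall>v. finite {w. F w $$ v \<noteq> 0})"

text \<open>
  Continuity at 0 for the topology given by the powers of the augmentation ideal; for
  linear maps this is continuity.
\<close>
definition nc_continuous :: "('k::field ncps \<Rightarrow> 'k ncps) \<Rightarrow> bool" where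
  "nc_continuous D \<longleftrightarrow>
     (\<forall>v. \<exists>N. \<forall>f. (\<forall>w. length w \<le> N \<longrightarrow> f $$ w = 0) \<longrightarrow> D f $$ v = 0)"

lemma finite_words: "finite {w :: letter list. length w \<le> N}"
proof -
  have "(UNIV :: letter set) = {X0, X1}"
    using letter.exhaust by auto
  then have "finite (UNIV :: letter set)"
    by (metis finite.emptyI finite.insertI)
  from finite_lists_length_le[OF this, of N] show ?thesis by simp
qed

definition nc_trunc :: "nat \<Rightarrow> 'k::field ncps \<Rightarrow> 'k ncps" where
  "nc_trunc N f = (\<Sum>w\<in>{w. length w \<le> N}. nc_scale (f $$ w) (nc_word w))"

lemma coeff_trunc: "nc_trunc N f $$ v = (if length v \<le> N then f $$ v else 0)"
  by (simp add: nc_trunc_def coeff_sum coeff_word if_distrib finite_words cong: if_cong)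

lemma coeff_ext:
  assumes "finite A" "{w. F w $$ v \<noteq> 0} \<subseteq> A"
  shows "nc_ext F f $$ v = (\<Sum>w\<in>A. f $$ w * F w $$ v)"
  unfolding nc_ext_def nc_sum_def coeff_Abs_ncps
  by (subst Sum_any.expand_superset[OF assms(1)]) (use assms(2) in auto)

lemma coeff_ext_lf:
  "nc_locally_finite F \<Longrightarrow> nc_ext F f $$ v = (\<Sum>w | F w $$ v \<noteq> 0. f $$ w * F w $$ v)"
  by (rule coeff_ext) (auto simp: nc_locally_finite_def)

lemma linear_nc_ext:
  assumes "nc_locally_finite F"
  shows "Vector_Spaces.linear nc_scale nc_scale (nc_ext F)"
  using assms
  by unfold_locales
    (simp_all add: ncps_eq_iff coeff_ext_lf algebra_simps sum.distrib sum_distrib_left)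

lemma nc_ext_word:
  assumes "nc_locally_finite F"
  shows "nc_ext F (nc_word w) = F w"
proof (rule ncps_eqI)
  fix v
  have "finite {w. F w $$ v \<noteq> 0}"
    using assms by (simp add: nc_locally_finite_def)
  then show "nc_ext F (nc_word w) $$ v = F w $$ v"
    by (subst coeff_ext[of "insert w {w. F w $$ v \<noteq> 0}"])
      (auto simp: coeff_word if_distrib[of "\<lambda>x. x * _"] cong: if_cong)
qed

lemma continuous_nc_ext:
  assumes "nc_locally_finite F"
  shows "nc_continuous (nc_ext F)"
  unfolding nc_continuous_def
proof
  fix v
  have fin: "finite (length ` {w. F w $$ v \<noteq> 0})"
    using assms by (simp add: nc_locally_finite_def)
  then obtain N where N: "\<And>w. F w $$ v \<noteq> 0 \<Longrightarrow> length w \<le> N"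
    by (auto simp: finite_nat_set_iff_bounded_le)
  have "nc_ext F f $$ v = 0" if "\<forall>w. length w \<le> N \<longrightarrow> f $$ w = 0" for f
    unfolding coeff_ext_lf[OF assms] using that N by (simp add: sum.neutral)
  then show "\<exists>N. \<forall>f. (\<forall>w. length w \<le> N \<longrightarrow> f $$ w = 0) \<longrightarrow> nc_ext F f $$ v = 0"
    by blast
qed

lemma continuous_linear_eqI:
  fixes D E :: "'k::field ncps \<Rightarrow> 'k ncps"
  assumes "Vector_Spaces.linear nc_scale nc_scale D" "nc_continuous D"
    and "Vector_Spaces.linear nc_scale nc_scale E" "nc_continuous E"
    and eq: "\<And>w. D (nc_word w) = E (nc_word w)"
  shows "D = E"
proof (intro ext ncps_eqI)
  fix f :: "'k ncps" and v
  interpret D: Vector_Spaces.linear nc_scale nc_scale D by fact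
  interpret E: Vector_Spaces.linear nc_scale nc_scale E by fact
  obtain M where M: "\<And>f. (\<forall>w. length w \<le> M \<longrightarrow> f $$ w = 0) \<Longrightarrow> D f $$ v = 0"
    using assms(2) unfolding nc_continuous_def by meson
  obtain N where N: "\<And>f. (\<forall>w. length w \<le> N \<longrightarrow> f $$ w = 0) \<Longrightarrow> E f $$ v = 0"
    using assms(4) unfolding nc_continuous_def by meson
  let ?t = "nc_trunc (max M N) f"
  have "D (f - ?t) $$ v = 0" by (rule M) (auto simp: coeff_trunc)
  moreover have "E (f - ?t) $$ v = 0" by (rule N) (auto simp: coeff_trunc)
  moreover have "D ?t = E ?t"
    by (simp add: nc_trunc_def D.sum E.sum D.scale E.scale eq)
  ultimately show "D f $$ v = E f $$ v"
    by (simp add: D.diff E.diff)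
qed

lemma nc_ext_unique:
  assumes "nc_locally_finite F"
  shows "D = nc_ext F \<longleftrightarrow> Vector_Spaces.linear nc_scale nc_scale D \<and> nc_continuous D \<and>
    (\<forall>w. D (nc_word w) = F w)"
  using continuous_linear_eqI linear_nc_ext[OF assms] continuous_nc_ext[OF assms]
    nc_ext_word[OF assms] by metis

section \<open>Lie series\<close>

inductive_set lie_polys :: "'k::field ncps set" where
  var: "nc_var i \<in> lie_polys"
| zero: "0 \<in> lie_polys"
| add: "f \<in> lie_polys \<Longrightarrow> g \<in> lie_polys \<Longrightarrow> f + g \<in> lie_polys"
| scale: "f \<in> lie_polys \<Longrightarrow> nc_scale c f \<in> lie_polys"
| br: "f \<in> lie_polys \<Longrightarrow> g \<in> lie_polys \<Longrightarrow> nc_br f g \<in> lie_polys"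

definition nc_component :: "nat \<Rightarrow> 'k::field ncps \<Rightarrow> 'k ncps" where
  "nc_component n f = Abs_ncps (\<lambda>w. if length w = n then f $$ w else 0)"

definition lie_series :: "'k::field ncps set" where
  "lie_series = {f. \<forall>n. nc_component n f \<in> lie_polys}"

section \<open>The maps in the reduced coaction equation\<close>

definition nc_dR :: "letter \<Rightarrow> 'k::field ncps \<Rightarrow> 'k ncps" where
  "nc_dR i f = Abs_ncps (\<lambda>w. f $$ (i # w))"

definition nc_dL :: "letter \<Rightarrow> 'k::field ncps \<Rightarrow> 'k ncps" where
  "nc_dL i f = Abs_ncps (\<lambda>w. f $$ (w @ [i]))"

lemma coeff_var_mult:
  "(nc_var i * f) $$ w = (case w of [] \<Rightarrow> 0 | j # v \<Rightarrow> if j = i then f $$ v else 0)"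
proof (cases w)
  case (Cons j v)
  have "(nc_var i * f) $$ w = (\<Sum>n\<le>length w. if n = 1 then if j = i then f $$ v else 0 else 0)"
    unfolding coeff_mult by (rule sum.cong) (auto simp: nc_var_def coeff_word Cons take_Cons')
  then show ?thesis by (auto simp: Cons Suc_le_eq)
qed (simp add: coeff_mult nc_var_def coeff_word)

lemma coeff_mult_var:
  "(f * nc_var i) $$ w = (if w \<noteq> [] \<and> last w = i then f $$ butlast w else 0)"
proof (cases w rule: rev_cases)
  case (snoc v j)
  have eq: "drop n w = [i] \<longleftrightarrow> n = length v \<and> j = i" if "n \<le> length w" for n
  proof
    assume d: "drop n w = [i]"
    then have "length w - n = 1" by (metis length_Cons length_drop list.size(3) One_nat_def)
    then show "n = length v \<and> j = i" using d by (simp add: snoc)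
  qed (simp add: snoc)
  have "(f * nc_var i) $$ w =
      (\<Sum>n\<le>length w. if n = length v then if j = i then f $$ v else 0 else 0)"
    unfolding coeff_mult nc_var_def coeff_word
    by (rule sum.cong[OF refl]) (use eq in \<open>simp add: snoc\<close>)
  then show ?thesis by (simp add: snoc)
qed (simp add: coeff_mult nc_var_def coeff_word)

text \<open>The defining decompositions of a series by first and by last letter.\<close>
lemma nc_dR_unique:
  "f = nc_scale (f $$ []) 1 + nc_var X0 * g0 + nc_var X1 * g1 \<longleftrightarrow>
     g0 = nc_dR X0 f \<and> g1 = nc_dR X1 f"
  (is "?L \<longleftrightarrow> ?R")
proof
  assume L: ?L
  have "g0 $$ w = f $$ (X0 # w)" "g1 $$ w = f $$ (X1 # w)" for w
    by (subst L, simp add: coeff_var_mult coeff_one)+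
  then show ?R by (simp add: ncps_eq_iff nc_dR_def)
next
  assume ?R
  have "f $$ w = (nc_scale (f $$ []) 1 + nc_var X0 * g0 + nc_var X1 * g1) $$ w" for w
    using \<open>?R\<close> letter.exhaust
    by (cases w) (auto simp: nc_dR_def coeff_var_mult coeff_one)
  then show ?L by (rule ncps_eqI)
qed

lemma nc_dL_unique:
  "f = nc_scale (f $$ []) 1 + g0 * nc_var X0 + g1 * nc_var X1 \<longleftrightarrow>
     g0 = nc_dL X0 f \<and> g1 = nc_dL X1 f"
  (is "?L \<longleftrightarrow> ?R")
proof
  assume L: ?L
  have "g0 $$ w = f $$ (w @ [X0])" "g1 $$ w = f $$ (w @ [X1])" for w
    by (subst L, simp add: coeff_mult_var coeff_one)+
  then show ?R by (simp add: ncps_eq_iff nc_dL_def)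
next
  assume ?R
  have "f $$ w = (nc_scale (f $$ []) 1 + g0 * nc_var X0 + g1 * nc_var X1) $$ w" for w
    using \<open>?R\<close> letter.exhaust
    by (cases w rule: rev_cases) (auto simp: nc_dL_def coeff_mult_var coeff_one)
  then show ?L by (rule ncps_eqI)
qed

definition letter_dot :: "letter \<Rightarrow> letter \<Rightarrow> 'k::field ncps" where
  "letter_dot i j = (if i = j then nc_var i else 0)"

text \<open>Letters are numbered from 0 here, so \<open>k\<^sub>i = w ! (i - 1)\<close>.\<close>
definition mu_word :: "letter list \<Rightarrow> 'k::field ncps" where
  "mu_word w = (\<Sum>i = 1..<length w.
     nc_word (take (i - 1) w) * letter_dot (w ! (i - 1)) (w ! i) * nc_word (drop (i + 1) w))"

definition nc_mu :: "'k::field ncps \<Rightarrow> 'k ncps" where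
  "nc_mu = nc_ext mu_word"

lemma mu_word_locally_finite: "nc_locally_finite mu_word"
  unfolding nc_locally_finite_def
proof
  fix v
  have "length w = Suc (length v)" if "mu_word w $$ v \<noteq> (0::'a)" for w
  proof -
    from that obtain i where i: "1 \<le> i" "i < length w"
      and "(nc_word (take (i - 1) w) * letter_dot (w ! (i - 1)) (w ! i) *
        nc_word (drop (i + 1) w)) $$ v \<noteq> (0::'a)"
      unfolding mu_word_def coeff_sum
      by (metis (no_types, lifting) atLeastLessThan_iff sum.not_neutral_contains_not_neutral)
    then have "nc_word (take (i - 1) w @ [w ! i] @ drop (i + 1) w) $$ v \<noteq> (0::'a)"
      unfolding nc_word_append letter_dot_def nc_var_def
      by (auto simp: mult.assoc split: if_splits)
    then have "v = take (i - 1) w @ [w ! i] @ drop (i + 1) w"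
      by (simp add: coeff_word split: if_splits)
    then show ?thesis using i by auto
  qed
  then show "finite {w. mu_word w $$ v \<noteq> (0::'a)}"
    by (auto intro!: finite_subset[OF _ finite_words[of "Suc (length v)"]])
qed

lemmas nc_mu_unique = nc_ext_unique[OF mu_word_locally_finite, folded nc_mu_def]

text \<open>\<open>r\<^sub>\<eta>(x)\<close>, for \<open>x\<close> without constant term.\<close>
definition nc_r :: "'k::field ncps \<Rightarrow> 'k ncps \<Rightarrow> 'k ncps" where
  "nc_r \<eta> x = nc_sum (\<lambda>l. nc_scale (\<eta> $$ (replicate (l + 1) X0 @ [X1])) (x ^ (l + 1)))"

text \<open>Substitution \<open>\<eta>(a, b)\<close>, for \<open>a\<close>, \<open>b\<close> without constant term.\<close>
definition nc_subst :: "'k::field ncps \<Rightarrow> 'k ncps \<Rightarrow> 'k ncps \<Rightarrow> 'k ncps" where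
  "nc_subst \<eta> a b = nc_ext (\<lambda>w. prod_list (map (case_letter a b) w)) \<eta>"

section \<open>The derivation \<open>d\<^sub>\<psi>\<close>\<close>

primrec der_word :: "'k::field ncps \<Rightarrow> letter list \<Rightarrow> 'k ncps" where
  "der_word \<psi> [] = 0"
| "der_word \<psi> (i # w) =
     (case i of X0 \<Rightarrow> 0 | X1 \<Rightarrow> nc_br (nc_var X1) \<psi>) * nc_word w + nc_var i * der_word \<psi> w"

definition nc_der :: "'k::field ncps \<Rightarrow> 'k ncps \<Rightarrow> 'k ncps" where
  "nc_der \<psi> = nc_ext (der_word \<psi>)"

lemma der_word_coeff: "length v < length w \<Longrightarrow> der_word \<psi> w $$ v = 0"
proof (induct w arbitrary: v)
  case (Cons i w)
  have 1: "(nc_br (nc_var X1) \<psi> * nc_word w) $$ v = 0"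
    unfolding coeff_mult
  proof (rule sum.neutral, rule ballI)
    fix n assume "n \<in> {..length v}"
    show "nc_br (nc_var X1) \<psi> $$ take n v * nc_word w $$ drop n v = 0"
    proof (cases "drop n v = w")
      case True
      then have "length v - n = length w" by auto
      then have "n = 0" using Cons.prems \<open>n \<in> {..length v}\<close> by auto
      then show ?thesis by (simp add: nc_br_def coeff_mult nc_var_def coeff_word)
    qed (simp add: coeff_word)
  qed
  have 2: "(nc_var i * der_word \<psi> w) $$ v = 0"
    using Cons by (auto simp: coeff_var_mult split: list.splits)
  show ?case using 1 2 by (simp split: letter.splits)
qed simp

lemma der_word_locally_finite: "nc_locally_finite (der_word \<psi>)"
  unfolding nc_locally_finite_def
proof
  fix v
  have "{w. der_word \<psi> w $$ v \<noteq> 0} \<subseteq> {w. length w \<le> length v}"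
    using der_word_coeff not_less by blast
  then show "finite {w. der_word \<psi> w $$ v \<noteq> 0}"
    by (rule finite_subset) (rule finite_words)
qed

lemma der_word_append:
  "der_word \<psi> (u @ w) = der_word \<psi> u * nc_word w + nc_word u * der_word \<psi> w"
  by (induct u) (simp_all add: nc_word_Nil nc_word_Cons nc_word_append algebra_simps)

lemma nc_der_leibniz: "nc_der \<psi> (f * g) = nc_der \<psi> f * g + f * nc_der \<psi> g"
proof (rule ncps_eqI)
  fix v :: "letter list"
  let ?N = "length v"
  interpret D: Vector_Spaces.linear nc_scale nc_scale "nc_der \<psi>"
    unfolding nc_der_def by (rule linear_nc_ext[OF der_word_locally_finite])
  have coeff: "nc_der \<psi> h $$ u = (\<Sum>w | length w \<le> length u. h $$ w * der_word \<psi> w $$ u)" for h u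
    unfolding nc_der_def
    by (rule coeff_ext[OF finite_words]) (use der_word_coeff not_less in blast)
  have local: "nc_der \<psi> h $$ u = nc_der \<psi> (nc_trunc ?N h) $$ u" if "length u \<le> ?N" for h u
    unfolding coeff using that by (auto simp: coeff_trunc intro!: sum.cong)
  have "nc_der \<psi> (f * g) $$ v = nc_der \<psi> (nc_trunc ?N f * nc_trunc ?N g) $$ v"
    unfolding coeff coeff_mult
    by (intro sum.cong refl) (simp add: coeff_trunc le_diff_conv trans_le_add1)
  also have "nc_der \<psi> (nc_trunc ?N f * nc_trunc ?N g) =
      nc_der \<psi> (nc_trunc ?N f) * nc_trunc ?N g + nc_trunc ?N f * nc_der \<psi> (nc_trunc ?N g)"
  proof -
    have "nc_der \<psi> (nc_word a * nc_word b) =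
        nc_der \<psi> (nc_word a) * nc_word b + nc_word a * nc_der \<psi> (nc_word b)" for a b
      unfolding nc_der_def nc_word_append[symmetric]
      by (simp only: nc_ext_word[OF der_word_locally_finite] der_word_append)
    then show ?thesis
      by (simp only: nc_trunc_def sum_product D.sum D.scale sum.distrib nc_scale_mult_left
          nc_scale_mult_right ncps.scale_right_distrib ncps.scale_scale)
  qed
  also have "\<dots> $$ v = (nc_der \<psi> f * g + f * nc_der \<psi> g) $$ v"
  proof -
    have "(nc_der \<psi> (nc_trunc ?N f) * nc_trunc ?N g) $$ v = (nc_der \<psi> f * g) $$ v"
      unfolding coeff_mult
      by (intro sum.cong refl arg_cong2[of _ _ _ _ "(*)"] local[symmetric])
        (simp_all add: coeff_trunc)
    moreover have "(nc_trunc ?N f * nc_der \<psi> (nc_trunc ?N g)) $$ v = (f * nc_der \<psi> g) $$ v"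
      unfolding coeff_mult
      by (intro sum.cong refl arg_cong2[of _ _ _ _ "(*)"] local[symmetric])
        (simp_all add: coeff_trunc)
    ultimately show ?thesis by simp
  qed
  finally show "nc_der \<psi> (f * g) $$ v = (nc_der \<psi> f * g + f * nc_der \<psi> g) $$ v" .
qed

text \<open>\<open>nc_der \<psi>\<close> is the unique continuous derivation with the prescribed values.\<close>
lemma nc_der_unique:
  "D = nc_der \<psi> \<longleftrightarrow> Vector_Spaces.linear nc_scale nc_scale D \<and> nc_continuous D \<and>
     (\<forall>f g. D (f * g) = D f * g + f * D g) \<and>
     D (nc_var X0) = 0 \<and> D (nc_var X1) = nc_br (nc_var X1) \<psi>"
  (is "_ \<longleftrightarrow> ?R")
proof
  note lf = der_word_locally_finite[of \<psi>]
  show ?R if "D = nc_der \<psi>"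
  proof -
    have "D (nc_var i) = der_word \<psi> [i]" for i
      unfolding that nc_der_def nc_var_def by (rule nc_ext_word[OF lf])
    then show ?thesis
      unfolding that
      using nc_der_leibniz linear_nc_ext[OF lf] continuous_nc_ext[OF lf]
      by (auto simp: nc_der_def nc_word_Nil)
  qed
  assume R: ?R
  then have leib: "D (f * g) = D f * g + f * D g" for f g by blast
  have one: "D 1 = 0" using leib[of 1 1] by simp
  have "D (nc_word w) = der_word \<psi> w" for w
  proof (induct w)
    case (Cons i w)
    then show ?case
      using R by (cases i) (simp_all add: nc_word_Cons leib)
  qed (simp add: nc_word_Nil one)
  then show "D = nc_der \<psi>"
    unfolding nc_der_def nc_ext_unique[OF lf] using R by blast
qed

definition ihara_bracket :: "'k::field ncps \<Rightarrow> 'k ncps \<Rightarrow> 'k ncps" where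
  "ihara_bracket \<psi>1 \<psi>2 = nc_der \<psi>2 \<psi>1 - nc_der \<psi>1 \<psi>2 - nc_br \<psi>1 \<psi>2"

section \<open>The space \<open>rc\<^sub>0\<close> and Lie algebras\<close>

definition rc0_bar :: "'k::field ncps set" where
  "rc0_bar = {\<eta> \<in> lie_series.
     \<eta> $$ [X0] = 0 \<and> \<eta> $$ [X1] = 0 \<and>
     \<eta> = - nc_subst \<eta> (nc_var X1) (nc_var X0) \<and>
     nc_dR X1 \<eta> + nc_mu \<eta> + nc_dL X0 \<eta> = - nc_r \<eta> (nc_var X1) + nc_r \<eta> (nc_var X0)}"

text \<open>A Lie algebra whose underlying space is a subspace \<open>V\<close> of an ambient vector space.\<close>
locale lie_algebra_on = vector_space scale
  for scale :: "'k::field \<Rightarrow> 'v::ab_group_add \<Rightarrow> 'v" +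
  fixes V :: "'v set" and br :: "'v \<Rightarrow> 'v \<Rightarrow> 'v"
  assumes subspace_carrier: "subspace V"
    and br_closed: "x \<in> V \<Longrightarrow> y \<in> V \<Longrightarrow> br x y \<in> V"
    and br_add_left: "x \<in> V \<Longrightarrow> y \<in> V \<Longrightarrow> z \<in> V \<Longrightarrow> br (x + y) z = br x z + br y z"
    and br_add_right: "x \<in> V \<Longrightarrow> y \<in> V \<Longrightarrow> z \<in> V \<Longrightarrow> br x (y + z) = br x y + br x z"
    and br_scale_left: "x \<in> V \<Longrightarrow> y \<in> V \<Longrightarrow> br (scale c x) y = scale c (br x y)"
    and br_scale_right: "x \<in> V \<Longrightarrow> y \<in> V \<Longrightarrow> br x (scale c y) = scale c (br x y)"
    and br_self: "x \<in> V \<Longrightarrow> br x x = 0"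
    and jacobi: "x \<in> V \<Longrightarrow> y \<in> V \<Longrightarrow> z \<in> V \<Longrightarrow>
      br x (br y z) + br y (br z x) + br z (br x y) = 0"

end

theory Submission
  imports Defs
begin

text \<open>
  Bilinearity and the Jacobi identity hold for the Ihara bracket on all series, because
  \<open>\<psi> \<mapsto> d\<^sub>\<psi>\<close> turns it into a commutator of derivations (\<open>nc_der_ihara_bracket\<close>). Skew-symmetry
  is preserved because, for \<open>\<psi>\<close> skew-symmetric, exchanging \<open>x\<^sub>0\<close> and \<open>x\<^sub>1\<close> conjugates
  \<open>d\<^sub>\<psi>\<close> into \<open>d\<^sub>\<psi> + [\<psi>, -]\<close>, and Lie series are closed under brackets and under \<open>d\<^sub>\<psi>\<close>. The point
  is the reduced coaction equation.

  Put \<open>C(f) = d\<^sup>R\<^sub>1(f) + \<mu>(f) + d\<^sup>L\<^sub>0(f)\<close>. Then \<open>x\<^sub>1 C(f) x\<^sub>0 = \<mu>(x\<^sub>1 f x\<^sub>0)\<close>: the two outer terms are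
  the contractions of \<open>f\<close> with a wall \<open>x\<^sub>1\<close> on its left and a wall \<open>x\<^sub>0\<close> on its right. On a word,
  \<open>d\<^sub>\<psi>\<close> inserts \<open>x\<^sub>1\<psi> - \<psi>x\<^sub>1\<close> at each \<open>x\<^sub>1\<close>, and these insertions telescope: what remains,
  apart from the two ends of the word, is one \<open>\<psi>\<close> with sign \<open>+\<close> in every gap \<open>x\<^sub>1|x\<^sub>0\<close> and one
  with sign \<open>-\<close> in every gap \<open>x\<^sub>0|x\<^sub>1\<close>. Between walls the term at the left end is compensated, so
  inserting \<open>\<psi>\<close> into the gaps of \<open>x\<^sub>1 f x\<^sub>0\<close> gives \<open>x\<^sub>1 (d\<^sub>\<psi>(f) + \<psi>f) x\<^sub>0\<close>.

  Now contract after inserting. Contractions away from the inserted \<open>\<psi>\<close> happen in gaps between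
  equal letters, where nothing is ever inserted, so they commute with the insertion. Contractions
  within \<open>\<psi>\<close> or between \<open>\<psi>\<close> and its neighbours replace \<open>\<psi>\<close> by \<open>C(\<psi>)\<close> in a gap \<open>x\<^sub>1|x\<^sub>0\<close>,
  and by the mirror image of \<open>C(\<psi>)\<close> in a gap \<open>x\<^sub>0|x\<^sub>1\<close>. For \<open>\<psi>\<close> in the space considered both
  are \<open>\<rho> = r\<^sub>\<psi>(x\<^sub>0) - r\<^sub>\<psi>(x\<^sub>1)\<close>, the second one by skew-symmetry. Hence (\<open>between_walls_insertion\<close>)
  \<open>C(d\<^sub>\<psi>(f) + \<psi>f) = d\<^sub>\<rho>(f) + \<rho>f + d\<^sub>\<psi>(C(f)) + \<psi>C(f)\<close>.

  The Ihara bracket of \<open>\<psi>\<close> and \<open>\<phi>\<close> is the antisymmetrisation of \<open>d\<^sub>\<phi>(\<psi>) + \<phi>\<psi>\<close>. Since a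
  power series in one letter commutes with this letter, the right-hand side above can be
  evaluated, and it turns out symmetric in \<open>\<psi>\<close> and \<open>\<phi>\<close> (\<open>between_walls_insertion_rc0\<close>). So
  \<open>C\<close> vanishes on the bracket. The series \<open>r\<close> of the bracket vanishes as well, because every word
  in the bracket contains \<open>x\<^sub>1\<close> at least twice (\<open>ihara_bracket_coeff_depth1\<close> is the part of this
  that matters), and the equation reads \<open>0 = 0\<close>.
\<close>

section \<open>Series letter by letter\<close>

lemma nc_dR_decomp:
  "f = nc_scale (f $$ []) 1 + nc_var X0 * nc_dR X0 f + nc_var X1 * nc_dR X1 f"
  using nc_dR_unique by blast

lemma coeff_mult_Nil [simp]: "(f * g) $$ [] = f $$ [] * g $$ []"
  by (simp add: coeff_mult)

lemma coeff_var_mult_Cons [simp]: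
  "(nc_var i * f) $$ (j # v) = (if j = i then f $$ v else 0)"
  by (simp add: coeff_var_mult)

lemma coeff_var_Nil [simp]: "nc_var i $$ [] = 0"
  by (simp add: nc_var_def coeff_word)

text \<open>Identities between series are proved by peeling off first letters: \<open>\<Delta> i f\<close> is the defect of the
  identity, and a recursion along the first letter of \<open>f\<close> pushes a nonzero coefficient of the
  defect to shorter and shorter words, until it sits at the empty word, where it cannot exist. The index \<open>i\<close> lets the identity depend on the letter to the left of \<open>f\<close>.\<close>
lemma vanishes_by_peeling:
  assumes "f \<in> P"
    and closed: "\<And>j f. f \<in> P \<Longrightarrow> nc_dR j f \<in> P"
    and peel: "\<And>i f. f \<in> P \<Longrightarrow>
      \<Delta> i f = nc_var X0 * \<Delta> X0 (nc_dR X0 f) + nc_var X1 * \<Delta> X1 (nc_dR X1 f)"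
  shows "\<Delta> i f = 0"
proof -
  have "\<Delta> i f $$ v = 0" if "f \<in> P" for i f v
    using that
  proof (induction v arbitrary: i f)
    case Nil
    then show ?case by (simp add: peel[of f])
  next
    case (Cons j v)
    then show ?case
      using closed by (cases j) (simp_all add: peel[of f])
  qed
  then show ?thesis using assms(1) by (auto intro: ncps_eqI)
qed

lemma nc_dR_add [simp]: "nc_dR i (f + g) = nc_dR i f + nc_dR i g"
  and nc_dR_diff [simp]: "nc_dR i (f - g) = nc_dR i f - nc_dR i g"
  and nc_dR_minus [simp]: "nc_dR i (- f) = - nc_dR i f"
  and nc_dR_scale [simp]: "nc_dR i (nc_scale c f) = nc_scale c (nc_dR i f)"
  and nc_dR_zero [simp]: "nc_dR i 0 = 0"
  and nc_dR_one [simp]: "nc_dR i 1 = 0"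
  and nc_dR_var_mult [simp]: "nc_dR i (nc_var j * g) = (if i = j then g else 0)"
  by (auto simp: ncps_eq_iff nc_dR_def coeff_one)

lemma nc_dR_mult: "nc_dR i (f * g) = nc_dR i f * g + nc_scale (f $$ []) (nc_dR i g)"
proof -
  have "f * g = nc_scale (f $$ []) g + nc_var X0 * (nc_dR X0 f * g) + nc_var X1 * (nc_dR X1 f * g)"
    by (subst nc_dR_decomp[of f]) (simp add: algebra_simps)
  then show ?thesis by (cases i) simp_all
qed

lemma nc_dL_add [simp]: "nc_dL i (f + g) = nc_dL i f + nc_dL i g"
  and nc_dL_diff [simp]: "nc_dL i (f - g) = nc_dL i f - nc_dL i g"
  and nc_dL_minus [simp]: "nc_dL i (- f) = - nc_dL i f"
  and nc_dL_scale [simp]: "nc_dL i (nc_scale c f) = nc_scale c (nc_dL i f)"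
  and nc_dL_one [simp]: "nc_dL i 1 = 0"
  by (auto simp: ncps_eq_iff nc_dL_def coeff_one)

lemma nc_dL_var_mult:
  "nc_dL i (nc_var j * g) = nc_var j * nc_dL i g + (if i = j then nc_scale (g $$ []) 1 else 0)"
  by (rule ncps_eqI) (simp add: nc_dL_def coeff_var_mult coeff_one split: list.splits)

lemma nc_var_mult_right_cancel:
  assumes "f * nc_var i = g * nc_var i"
  shows "f = g"
proof (rule ncps_eqI)
  fix w
  have "(f * nc_var i) $$ (w @ [i]) = (g * nc_var i) $$ (w @ [i])" using assms by simp
  then show "f $$ w = g $$ w" by (simp add: coeff_mult_var)
qed

section \<open>The reduced coaction\<close>

text \<open>A word is contracted to \<open>v\<close> in as many ways as it arises from \<open>v\<close> by doubling one letter. This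
  description of \<open>\<mu>\<close> by its coefficients is local, so no infinite sums are left.\<close>
definition mu_coeff :: "'k::field ncps \<Rightarrow> letter list \<Rightarrow> 'k" where
  "mu_coeff f v = (\<Sum>i<length v. f $$ (take (Suc i) v @ drop i v))"

lemma mu_coeff_Nil [simp]: "mu_coeff f [] = 0"
  by (simp add: mu_coeff_def)

lemma mu_coeff_Cons [simp]: "mu_coeff f (j # v) = f $$ (j # j # v) + mu_coeff (nc_dR j f) v"
  by (simp add: mu_coeff_def nc_dR_def sum.lessThan_Suc_shift del: sum.lessThan_Suc)

lemma mu_coeff_zero [simp]: "mu_coeff 0 v = 0"
  by (simp add: mu_coeff_def)

lemma nc_dR_word: "nc_dR j (nc_word (i # w)) = (if i = j then nc_word w else 0)"
  by (simp add: nc_word_Cons)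

lemma mu_word_Cons:
  "mu_word (i # j # w) = letter_dot i j * nc_word w + nc_var i * mu_word (j # w)"
proof -
  have "mu_word (i # j # w) = letter_dot i j * nc_word w +
      (\<Sum>n = Suc 1..<Suc (length (j # w)). nc_word (take (n - 1) (i # j # w)) *
        letter_dot ((i # j # w) ! (n - 1)) ((i # j # w) ! n) * nc_word (drop (n + 1) (i # j # w)))"
    unfolding mu_word_def
    by (subst sum.atLeast_Suc_lessThan) (simp_all add: nc_word_Nil)
  also have "(\<Sum>n = Suc 1..<Suc (length (j # w)). nc_word (take (n - 1) (i # j # w)) *
        letter_dot ((i # j # w) ! (n - 1)) ((i # j # w) ! n) * nc_word (drop (n + 1) (i # j # w)))
      = nc_var i * mu_word (j # w)"
    unfolding mu_word_def sum.shift_bounds_Suc_ivl sum_distrib_left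
    by (rule sum.cong) (auto simp: take_Cons' nth_Cons' nc_word_Cons mult.assoc)
  finally show ?thesis .
qed

lemma mu_coeff_word: "mu_coeff (nc_word w) v = mu_word w $$ v"
proof (induction w arbitrary: v)
  case Nil
  show ?case
    by (cases v) (simp_all add: mu_word_def nc_word_Nil coeff_one)
next
  case (Cons i w)
  show ?case
  proof (cases w)
    case Nil
    have "mu_coeff (nc_word []) u = (0 :: 'a)" for u
      using Cons.IH[of u] by (simp add: Nil mu_word_def)
    then show ?thesis
      by (cases v) (auto simp: Nil mu_word_def nc_dR_word coeff_word)
  next
    case [simp]: (Cons j u)
    show ?thesis
    proof (cases v)
      case (Cons l t)
      then show ?thesis
        using Cons.IH[of t]
        by (auto simp: mu_word_Cons nc_dR_word letter_dot_def coeff_word)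
    qed (simp add: mu_word_Cons letter_dot_def)
  qed
qed

lemma coeff_mu: "nc_mu f $$ v = mu_coeff f v"
proof -
  have "(\<lambda>f. Abs_ncps (mu_coeff f)) = (nc_mu :: 'a ncps \<Rightarrow> 'a ncps)"
    unfolding nc_mu_unique
  proof (intro conjI allI)
    show "Vector_Spaces.linear nc_scale nc_scale (\<lambda>f :: 'a ncps. Abs_ncps (mu_coeff f))"
      by unfold_locales
        (simp_all add: ncps_eq_iff mu_coeff_def sum.distrib sum_distrib_left algebra_simps)
    show "nc_continuous (\<lambda>f :: 'a ncps. Abs_ncps (mu_coeff f))"
      unfolding nc_continuous_def
    proof (intro allI exI impI)
      fix v :: "letter list" and f :: "'a ncps"
      assume "\<forall>w. length w \<le> Suc (length v) \<longrightarrow> f $$ w = 0"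
      then show "Abs_ncps (mu_coeff f) $$ v = 0"
        by (auto simp: mu_coeff_def intro!: sum.neutral)
    qed
    show "Abs_ncps (mu_coeff (nc_word w :: 'a ncps)) = mu_word w" for w
      by (simp add: ncps_eq_iff mu_coeff_word)
  qed
  from fun_cong[OF this, of f] have "nc_mu f = Abs_ncps (mu_coeff f)" by simp
  then show ?thesis by simp
qed

lemma nc_mu_add [simp]: "nc_mu (f + g) = nc_mu f + nc_mu g"
  and nc_mu_diff [simp]: "nc_mu (f - g) = nc_mu f - nc_mu g"
  and nc_mu_minus [simp]: "nc_mu (- f) = - nc_mu f"
  and nc_mu_scale [simp]: "nc_mu (nc_scale c f) = nc_scale c (nc_mu f)"
  and nc_mu_zero [simp]: "nc_mu 0 = 0"
  by (simp_all add: ncps_eq_iff coeff_mu mu_coeff_def sum.distrib sum_subtractf sum_negf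
      sum_distrib_left)

lemma nc_mu_one [simp]: "nc_mu 1 = 0"
proof (rule ncps_eqI)
  show "nc_mu 1 $$ w = (0 :: 'a ncps) $$ w" for w
    using mu_coeff_word[of "[]" w] by (simp add: coeff_mu nc_word_Nil mu_word_def)
qed

text \<open>Contraction behind a letter \<open>x\<^sub>i\<close>, which itself is not recorded in the result:
  \<open>\<mu>(x\<^sub>i f) = x\<^sub>i \<cdot> mu_after i f\<close>.\<close>
definition mu_after :: "letter \<Rightarrow> 'k::field ncps \<Rightarrow> 'k ncps" where
  "mu_after i f = nc_mu f + nc_dR i f"

lemma nc_mu_var_mult: "nc_mu (nc_var i * f) = nc_var i * mu_after i f"
proof (rule ncps_eqI)
  fix w
  show "nc_mu (nc_var i * f) $$ w = (nc_var i * mu_after i f) $$ w"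
    by (cases w) (auto simp: coeff_mu mu_after_def nc_dR_def[of _ f])
qed

lemma mu_after_simps [simp]:
  "mu_after i (f + g) = mu_after i f + mu_after i g"
  "mu_after i (f - g) = mu_after i f - mu_after i g"
  "mu_after i (- f) = - mu_after i f"
  "mu_after i (nc_scale c f) = nc_scale c (mu_after i f)"
  "mu_after i 0 = 0" "mu_after i 1 = 0"
  by (simp_all add: mu_after_def algebra_simps ncps.scale_right_distrib)

lemma mu_after_var_mult:
  "mu_after i (nc_var j * f) = nc_var j * mu_after j f + (if i = j then f else 0)"
  by (simp add: mu_after_def[of i] nc_mu_var_mult)

text \<open>A contraction in \<open>f x\<^sub>j g\<close> either takes place in \<open>f\<close>, or uses the last letter of \<open>f\<close> together
  with \<open>x\<^sub>j\<close>, or takes place in \<open>x\<^sub>j g\<close>.\<close>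
lemma nc_mu_mult_var_mult:
  "nc_mu (f * (nc_var j * g)) =
    (nc_mu f + nc_dL j f) * (nc_var j * g) + f * (nc_var j * mu_after j g)"
proof -
  define \<Delta> where "\<Delta> f = nc_mu (f * (nc_var j * g)) -
    (nc_mu f + nc_dL j f) * (nc_var j * g) - f * (nc_var j * mu_after j g)" for f
  have add: "\<Delta> (f + h) = \<Delta> f + \<Delta> h" for f h
    by (simp add: \<Delta>_def algebra_simps)
  have const: "\<Delta> (nc_scale c 1) = 0" for c
    by (simp add: \<Delta>_def nc_mu_var_mult)
  have var: "\<Delta> (nc_var l * h) = nc_var l * \<Delta> h" for l h
    by (simp add: \<Delta>_def nc_mu_var_mult nc_dL_var_mult mult.assoc mu_after_def[of l] nc_dR_mult[of l h]
        algebra_simps)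
  have "\<Delta> f = 0"
  proof (rule vanishes_by_peeling[of f UNIV "\<lambda>_. \<Delta>"])
    show "\<Delta> h = nc_var X0 * \<Delta> (nc_dR X0 h) + nc_var X1 * \<Delta> (nc_dR X1 h)" for h
      by (subst nc_dR_decomp[of h]) (simp only: add const var add_0)
  qed simp_all
  then show ?thesis by (simp add: \<Delta>_def algebra_simps)
qed

text \<open>For \<open>i = j\<close> the constant term of \<open>f\<close> would cause an additional contraction of the two
  neighbours of \<open>f\<close> with each other.\<close>
lemma mu_after_mult_var_mult:
  assumes "i \<noteq> j"
  shows "mu_after i (f * (nc_var j * g)) =
    (nc_dR i f + nc_mu f + nc_dL j f) * (nc_var j * g) + f * (nc_var j * mu_after j g)"
  using assms
  by (simp add: mu_after_def[of i] nc_mu_mult_var_mult nc_dR_mult[of i f] algebra_simps)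

section \<open>Derivations\<close>

definition nc_derivation :: "('k::field ncps \<Rightarrow> 'k ncps) \<Rightarrow> bool" where
  "nc_derivation D \<longleftrightarrow> Vector_Spaces.linear nc_scale nc_scale D \<and>
    (\<forall>f g. D (f * g) = D f * g + f * D g)"

lemma nc_derivationI:
  assumes "\<And>f g. D (f + g) = D f + D g" "\<And>c f. D (nc_scale c f) = nc_scale c (D f)"
    "\<And>f g. D (f * g) = D f * g + f * D g"
  shows "nc_derivation D"
  unfolding nc_derivation_def using assms by (auto intro!: Vector_Spaces.linear.intro
    module_hom.intro module_hom_axioms.intro ncps.vector_space_axioms ncps.module_axioms)

lemma nc_derivation_add: "nc_derivation D \<Longrightarrow> D (f + g) = D f + D g"
  and nc_derivation_diff: "nc_derivation D \<Longrightarrow> D (f - g) = D f - D g"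
  and nc_derivation_minus: "nc_derivation D \<Longrightarrow> D (- f) = - D f"
  and nc_derivation_zero: "nc_derivation D \<Longrightarrow> D 0 = 0"
  and nc_derivation_scale: "nc_derivation D \<Longrightarrow> D (nc_scale c f) = nc_scale c (D f)"
  and nc_derivation_mult: "nc_derivation D \<Longrightarrow> D (f * g) = D f * g + f * D g"
proof -
  assume "nc_derivation D"
  then interpret D: Vector_Spaces.linear nc_scale nc_scale D
    by (simp add: nc_derivation_def)
  show "D (f + g) = D f + D g" "D (f - g) = D f - D g" "D (- f) = - D f" "D 0 = 0"
    "D (nc_scale c f) = nc_scale c (D f)" by (fact D.add D.diff D.neg D.zero D.scale)+
  show "D (f * g) = D f * g + f * D g"
    using \<open>nc_derivation D\<close> by (simp add: nc_derivation_def)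
qed

lemma nc_derivation_one: "nc_derivation D \<Longrightarrow> D 1 = 0"
  using nc_derivation_mult[of D 1 1] by simp

definition nc_over :: "letter set \<Rightarrow> 'k::field ncps set" where
  "nc_over S = {f. \<forall>w. f $$ w \<noteq> 0 \<longrightarrow> set w \<subseteq> S}"

text \<open>Derivations are determined by their values on the letters. They need to agree only on the letters
  that occur in \<open>f\<close>, which makes the lemma applicable to power series in a single letter.\<close>
lemma nc_derivation_eqI:
  assumes D: "nc_derivation D" and E: "nc_derivation E"
    and eq: "\<And>i. i \<in> S \<Longrightarrow> D (nc_var i) = E (nc_var i)"
    and f: "f \<in> nc_over S"
  shows "D f = E f"
proof -
  have "D f - E f = 0"
  proof (rule vanishes_by_peeling[where \<Delta> = "\<lambda>_ f. D f - E f", OF f])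
    show "nc_dR j f \<in> nc_over S" if "f \<in> nc_over S" for j f
    proof -
      have "set w \<subseteq> S" if "f $$ (j # w) \<noteq> 0" for w
        using that \<open>f \<in> nc_over S\<close> by (auto simp: nc_over_def dest!: spec[where x = "j # w"])
      then show ?thesis by (simp add: nc_over_def nc_dR_def)
    qed
    fix f :: "'a ncps" assume f: "f \<in> nc_over S"
    have eq': "D (nc_var i) * nc_dR i f = E (nc_var i) * nc_dR i f" for i
    proof (cases "i \<in> S")
      case False
      with f have "nc_dR i f = 0"
        by (fastforce simp: nc_over_def nc_dR_def ncps_eq_iff)
      then show ?thesis by simp
    qed (simp add: eq)
    have split: "G f = (G (nc_var X0) * nc_dR X0 f + nc_var X0 * G (nc_dR X0 f)) +
        (G (nc_var X1) * nc_dR X1 f + nc_var X1 * G (nc_dR X1 f))" if "nc_derivation G" for G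
      by (subst nc_dR_decomp[of f])
        (simp only: nc_derivation_add[OF that] nc_derivation_scale[OF that]
          nc_derivation_mult[OF that] nc_derivation_one[OF that] ncps.scale_zero_right add_0)
    show "D f - E f = nc_var X0 * (D (nc_dR X0 f) - E (nc_dR X0 f)) +
        nc_var X1 * (D (nc_dR X1 f) - E (nc_dR X1 f))"
      by (subst split[OF D], subst split[OF E]) (simp add: eq' algebra_simps)
  qed
  then show ?thesis by simp
qed

lemma nc_derivation_ext:
  assumes "nc_derivation D" "nc_derivation E"
    and "\<And>i. D (nc_var i) = E (nc_var i)"
  shows "D f = E f"
  using nc_derivation_eqI[of D E UNIV f] assms by (simp add: nc_over_def)

lemma nc_derivation_der: "nc_derivation (nc_der \<psi>)"
  using nc_der_unique[of "nc_der \<psi>" \<psi>] by (simp add: nc_derivation_def)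

lemma nc_der_simps [simp]:
  "nc_der \<psi> (f + g) = nc_der \<psi> f + nc_der \<psi> g"
  "nc_der \<psi> (f - g) = nc_der \<psi> f - nc_der \<psi> g"
  "nc_der \<psi> (- f) = - nc_der \<psi> f"
  "nc_der \<psi> (nc_scale c f) = nc_scale c (nc_der \<psi> f)"
  "nc_der \<psi> 0 = 0" "nc_der \<psi> 1 = 0"
  by (fact nc_derivation_add[OF nc_derivation_der] nc_derivation_diff[OF nc_derivation_der]
      nc_derivation_minus[OF nc_derivation_der] nc_derivation_scale[OF nc_derivation_der]
      nc_derivation_zero[OF nc_derivation_der] nc_derivation_one[OF nc_derivation_der])+

lemma nc_der_var [simp]:
  "nc_der \<psi> (nc_var X0) = 0" "nc_der \<psi> (nc_var X1) = nc_br (nc_var X1) \<psi>"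
  using nc_der_unique[of "nc_der \<psi>" \<psi>] by simp_all

lemma nc_der_br: "nc_der \<psi> (nc_br f g) = nc_br (nc_der \<psi> f) g + nc_br f (nc_der \<psi> g)"
  by (simp add: nc_br_def nc_der_leibniz algebra_simps)

lemma nc_derivation_br: "nc_derivation (nc_br g)"
  by (rule nc_derivationI)
    (simp_all add: nc_br_def algebra_simps ncps.scale_right_diff_distrib)

lemma nc_derivation_plus:
  "nc_derivation D \<Longrightarrow> nc_derivation E \<Longrightarrow> nc_derivation (\<lambda>f. D f + E f)"
  by (rule nc_derivationI)
    (simp_all add: nc_derivation_add nc_derivation_scale nc_derivation_mult algebra_simps
      ncps.scale_right_distrib)

lemma nc_derivation_scaled:
  "nc_derivation D \<Longrightarrow> nc_derivation (\<lambda>f. nc_scale c (D f))"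
  by (rule nc_derivationI)
    (simp_all add: nc_derivation_add nc_derivation_scale nc_derivation_mult
      ncps.scale_right_distrib mult.commute)

lemma nc_derivation_commutator:
  "nc_derivation D \<Longrightarrow> nc_derivation E \<Longrightarrow> nc_derivation (\<lambda>f. D (E f) - E (D f))"
  by (rule nc_derivationI)
    (simp_all add: nc_derivation_add nc_derivation_scale nc_derivation_mult algebra_simps
      ncps.scale_right_diff_distrib)

lemma nc_der_add_index: "nc_der (\<psi> + \<phi>) f = nc_der \<psi> f + nc_der \<phi> f"
proof (rule nc_derivation_ext[OF nc_derivation_der])
  show "nc_derivation (\<lambda>f. nc_der \<psi> f + nc_der \<phi> f)"
    by (intro nc_derivation_plus nc_derivation_der)
  show "nc_der (\<psi> + \<phi>) (nc_var i) = nc_der \<psi> (nc_var i) + nc_der \<phi> (nc_var i)" for i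
    by (cases i) (simp_all add: nc_br_def algebra_simps)
qed

lemma nc_der_scale_index: "nc_der (nc_scale c \<psi>) f = nc_scale c (nc_der \<psi> f)"
proof (rule nc_derivation_ext[OF nc_derivation_der])
  show "nc_derivation (\<lambda>f. nc_scale c (nc_der \<psi> f))"
    by (intro nc_derivation_scaled nc_derivation_der)
  show "nc_der (nc_scale c \<psi>) (nc_var i) = nc_scale c (nc_der \<psi> (nc_var i))" for i
    by (cases i) (simp_all add: nc_br_def ncps.scale_right_diff_distrib)
qed

section \<open>The Ihara bracket\<close>

text \<open>This is where the Ihara bracket comes from: \<open>[d\<^sub>\<phi>, d\<^sub>\<psi>]\<close> kills \<open>x\<^sub>0\<close> and sends \<open>x\<^sub>1\<close> to a
  bracket \<open>[x\<^sub>1, -]\<close>, so it is again one of the derivations \<open>d\<close>.\<close>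
lemma nc_der_ihara_bracket:
  "nc_der (ihara_bracket \<psi> \<phi>) f = nc_der \<phi> (nc_der \<psi> f) - nc_der \<psi> (nc_der \<phi> f)"
proof (rule nc_derivation_ext[OF nc_derivation_der])
  show "nc_derivation (\<lambda>f. nc_der \<phi> (nc_der \<psi> f) - nc_der \<psi> (nc_der \<phi> f))"
    by (intro nc_derivation_commutator nc_derivation_der)
  show "nc_der (ihara_bracket \<psi> \<phi>) (nc_var i) =
      nc_der \<phi> (nc_der \<psi> (nc_var i)) - nc_der \<psi> (nc_der \<phi> (nc_var i))" for i
    by (cases i) (simp_all add: nc_der_br, simp add: nc_br_def ihara_bracket_def algebra_simps)
qed

lemma ihara_bracket_add_left:
    "ihara_bracket (f + g) h = ihara_bracket f h + ihara_bracket g h"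
  and ihara_bracket_add_right:
    "ihara_bracket h (f + g) = ihara_bracket h f + ihara_bracket h g"
  and ihara_bracket_scale_left:
    "ihara_bracket (nc_scale c f) h = nc_scale c (ihara_bracket f h)"
  and ihara_bracket_scale_right:
    "ihara_bracket h (nc_scale c f) = nc_scale c (ihara_bracket h f)"
  by (simp_all add: ihara_bracket_def nc_der_add_index nc_der_scale_index nc_br_def
      ncps.scale_right_diff_distrib algebra_simps)

text \<open>Written out, the terms with two derivations cancel in the cyclic sum since \<open>\<psi> \<mapsto> d\<^sub>\<psi>\<close> reverses
  brackets; the terms with one derivation cancel by the Leibniz rule; the rest is the Jacobi
  identity of the commutator.\<close>
lemma ihara_bracket_jacobi:
  "ihara_bracket f (ihara_bracket g h) + ihara_bracket g (ihara_bracket h f) +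
    ihara_bracket h (ihara_bracket f g) = 0"
proof -
  have expand: "ihara_bracket f (ihara_bracket g h) =
      nc_der h (nc_der g f) - nc_der g (nc_der h f)
      - nc_der f (nc_der h g) + nc_der f (nc_der g h) + nc_br (nc_der f g) h + nc_br g (nc_der f h)
      - nc_br f (nc_der h g) + nc_br f (nc_der g h) + nc_br f (nc_br g h)" for f g h :: "'a ncps"
  proof -
    have "ihara_bracket f (ihara_bracket g h) =
        nc_der (ihara_bracket g h) f - nc_der f (ihara_bracket g h) - nc_br f (ihara_bracket g h)"
      by (simp only: ihara_bracket_def[of f])
    then show ?thesis
      unfolding nc_der_ihara_bracket
      by (simp add: ihara_bracket_def nc_der_br) (simp add: nc_br_def algebra_simps)
  qed
  show ?thesis
    unfolding expand by (simp add: nc_br_def algebra_simps)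
qed

section \<open>Exchanging the two letters\<close>

primrec other :: "letter \<Rightarrow> letter" where
  "other X0 = X1" | "other X1 = X0"

lemma other_other [simp]: "other (other i) = i"
  by (cases i) auto

lemma other_comp_other [simp]: "other \<circ> other = id"
  by (simp add: fun_eq_iff)

lemma map_other_other: "map other (map other w) = w"
  by simp

definition nc_swap :: "'k::field ncps \<Rightarrow> 'k ncps" where
  "nc_swap f = Abs_ncps (\<lambda>w. f $$ map other w)"

lemma coeff_swap: "nc_swap f $$ w = f $$ map other w"
  by (simp add: nc_swap_def)

lemma nc_subst_swap: "nc_subst f (nc_var X1) (nc_var X0) = nc_swap f"
proof (rule ncps_eqI)
  fix v
  have prod: "prod_list (map (case_letter (nc_var X1) (nc_var X0)) w) =
      (nc_word (map other w) :: 'a ncps)" for w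
    by (induction w) (auto simp: nc_word_Nil nc_word_Cons split: letter.splits)
  have "nc_subst f (nc_var X1) (nc_var X0) $$ v =
      (\<Sum>w\<in>{map other v}. f $$ w * nc_word (map other w) $$ v)"
    unfolding nc_subst_def prod by (rule coeff_ext) (auto simp: coeff_word)
  then show "nc_subst f (nc_var X1) (nc_var X0) $$ v = nc_swap f $$ v"
    by (simp add: coeff_word coeff_swap)
qed

lemma nc_swap_add [simp]: "nc_swap (f + g) = nc_swap f + nc_swap g"
  and nc_swap_diff [simp]: "nc_swap (f - g) = nc_swap f - nc_swap g"
  and nc_swap_minus [simp]: "nc_swap (- f) = - nc_swap f"
  and nc_swap_scale [simp]: "nc_swap (nc_scale c f) = nc_scale c (nc_swap f)"
  and nc_swap_mult [simp]: "nc_swap (f * g) = nc_swap f * nc_swap g"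
  and nc_swap_zero [simp]: "nc_swap 0 = 0"
  and nc_swap_swap [simp]: "nc_swap (nc_swap f) = f"
  by (simp_all add: ncps_eq_iff coeff_swap coeff_mult take_map drop_map o_def)

lemma nc_swap_var [simp]: "nc_swap (nc_var i) = nc_var (other i)"
proof -
  have "map other w = [i] \<longleftrightarrow> w = [other i]" for w
    by (metis list.map(1,2) map_other_other)
  then show ?thesis by (simp add: ncps_eq_iff coeff_swap nc_var_def coeff_word)
qed

lemma nc_swap_dR: "nc_swap (nc_dR i f) = nc_dR (other i) (nc_swap f)"
  and nc_swap_dL: "nc_swap (nc_dL i f) = nc_dL (other i) (nc_swap f)"
  and nc_swap_mu: "nc_swap (nc_mu f) = nc_mu (nc_swap f)"
  by (simp_all add: ncps_eq_iff coeff_swap nc_dR_def nc_dL_def coeff_mu mu_coeff_def take_map drop_map)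

text \<open>The conjugate of \<open>d\<^sub>\<psi>\<close> under the exchange kills \<open>x\<^sub>1\<close> and sends \<open>x\<^sub>0\<close> to \<open>[x\<^sub>0, -\<psi>]\<close>, which are the
  values of \<open>d\<^sub>\<psi> + [\<psi>, -]\<close>.\<close>
lemma nc_swap_der:
  assumes "nc_swap \<psi> = - \<psi>"
  shows "nc_swap (nc_der \<psi> f) = nc_der \<psi> (nc_swap f) + nc_br \<psi> (nc_swap f)"
proof -
  have "nc_swap (nc_der \<psi> (nc_swap g)) = nc_der \<psi> g + nc_br \<psi> g" for g
  proof (rule nc_derivation_ext[of "\<lambda>g. nc_swap (nc_der \<psi> (nc_swap g))"
        "\<lambda>g. nc_der \<psi> g + nc_br \<psi> g"])
    show "nc_derivation (\<lambda>g. nc_swap (nc_der \<psi> (nc_swap g)))"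
      by (rule nc_derivationI) (simp_all add: nc_der_leibniz)
    show "nc_derivation (\<lambda>g. nc_der \<psi> g + nc_br \<psi> g)"
      by (intro nc_derivation_plus nc_derivation_der nc_derivation_br)
    show "nc_swap (nc_der \<psi> (nc_swap (nc_var i))) = nc_der \<psi> (nc_var i) + nc_br \<psi> (nc_var i)" for i
      by (cases i) (simp_all add: nc_br_def assms)
  qed
  from this[of "nc_swap f"] show ?thesis by simp
qed

lemma nc_swap_ihara_bracket:
  assumes "nc_swap \<psi> = - \<psi>" "nc_swap \<phi> = - \<phi>"
  shows "nc_swap (ihara_bracket \<psi> \<phi>) = - ihara_bracket \<psi> \<phi>"
  by (simp add: ihara_bracket_def nc_swap_der assms) (simp add: nc_br_def assms algebra_simps)

section \<open>Lie series\<close>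

lemma coeff_component: "nc_component n f $$ w = (if length w = n then f $$ w else 0)"
  by (simp add: nc_component_def)

lemma nc_component_add: "nc_component n (f + g) = nc_component n f + nc_component n g"
  and nc_component_diff: "nc_component n (f - g) = nc_component n f - nc_component n g"
  and nc_component_zero: "nc_component n 0 = 0"
  and nc_component_scale: "nc_component n (nc_scale c f) = nc_scale c (nc_component n f)"
  by (auto simp: ncps_eq_iff coeff_component)

lemma nc_component_mult:
  "nc_component n (f * g) = (\<Sum>i\<le>n. nc_component i f * nc_component (n - i) g)"
proof (rule ncps_eqI)
  fix w
  have "(nc_component i f * nc_component (n - i) g) $$ w =
      (if length w = n then f $$ take i w * g $$ drop i w else 0)" if "i \<le> n" for i
  proof -
    have "(nc_component i f * nc_component (n - i) g) $$ w =
        (\<Sum>j\<le>length w. if j = i \<and> length w = n then f $$ take i w * g $$ drop i w else 0)"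
      unfolding coeff_mult by (rule sum.cong) (use that in \<open>auto simp: coeff_component\<close>)
    then show ?thesis using that by auto
  qed
  then have "(\<Sum>i\<le>n. nc_component i f * nc_component (n - i) g) $$ w =
      (\<Sum>i\<le>n. if length w = n then f $$ take i w * g $$ drop i w else 0)"
    unfolding coeff_sum by (intro sum.cong) auto
  then show "nc_component n (f * g) $$ w =
      (\<Sum>i\<le>n. nc_component i f * nc_component (n - i) g) $$ w"
    by (auto simp: coeff_component coeff_mult[of f])
qed

lemma nc_component_br:
  "nc_component n (nc_br f g) = (\<Sum>i\<le>n. nc_br (nc_component i f) (nc_component (n - i) g))"
proof -
  have "(\<Sum>i\<le>n. nc_component i g * nc_component (n - i) f) =
      (\<Sum>i\<le>n. nc_component (n - i) g * nc_component i f)"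
    by (rule sum.reindex_bij_witness[where i = "\<lambda>i. n - i" and j = "\<lambda>i. n - i"]) auto
  then show ?thesis
    by (simp add: nc_br_def nc_component_diff nc_component_mult sum_subtractf)
qed

lemma lie_polys_sum: "(\<And>i. i \<in> I \<Longrightarrow> F i \<in> lie_polys) \<Longrightarrow> (\<Sum>i\<in>I. F i) \<in> lie_polys"
  by (induct I rule: infinite_finite_induct) (auto intro: lie_polys.intros)

lemma lie_series_zero: "0 \<in> lie_series"
  and lie_series_add: "f \<in> lie_series \<Longrightarrow> g \<in> lie_series \<Longrightarrow> f + g \<in> lie_series"
  and lie_series_scale: "f \<in> lie_series \<Longrightarrow> nc_scale c f \<in> lie_series"
  and lie_series_br: "f \<in> lie_series \<Longrightarrow> g \<in> lie_series \<Longrightarrow> nc_br f g \<in> lie_series"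
  by (auto simp: lie_series_def nc_component_add nc_component_zero nc_component_scale
      nc_component_br intro!: lie_polys_sum intro: lie_polys.intros)

lemma lie_series_diff: "f \<in> lie_series \<Longrightarrow> g \<in> lie_series \<Longrightarrow> f - g \<in> lie_series"
  using lie_series_add[of f "nc_scale (-1) g"] lie_series_scale[of g "-1"] by simp

lemma lie_series_var: "(nc_var i :: 'a::field ncps) \<in> lie_series"
proof -
  have "nc_component n (nc_var i :: 'a ncps) = (if n = 1 then nc_var i else 0)" for n
    by (auto simp: ncps_eq_iff coeff_component nc_var_def coeff_word)
  then show ?thesis by (auto simp: lie_series_def intro: lie_polys.intros)
qed

lemma nc_der_lie_poly:
  assumes "\<psi> \<in> lie_series" "f \<in> lie_polys"
  shows "f \<in> lie_series \<and> nc_der \<psi> f \<in> lie_series"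
  using assms(2)
proof induction
  case (var i)
  then show ?case
    using assms(1) by (cases i) (auto intro: lie_series_zero lie_series_var lie_series_br)
qed (auto simp: nc_der_br intro: lie_series_zero lie_series_add lie_series_scale lie_series_br)

lemma nc_der_coeff_local:
  assumes "\<And>w. length w \<le> length v \<Longrightarrow> f $$ w = g $$ w"
  shows "nc_der \<psi> f $$ v = nc_der \<psi> g $$ v"
proof -
  have "nc_der \<psi> h $$ v = (\<Sum>w | length w \<le> length v. h $$ w * der_word \<psi> w $$ v)" for h
    unfolding nc_der_def
    by (rule coeff_ext[OF finite_words]) (use der_word_coeff not_less in blast)
  then show ?thesis using assms by auto
qed

lemma lie_series_der:
  assumes "\<psi> \<in> lie_series" "f \<in> lie_series"
  shows "nc_der \<psi> f \<in> lie_series"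
  unfolding lie_series_def
proof (intro CollectI allI)
  fix n
  \<comment> \<open>\<open>d\<^sub>\<psi>\<close> does not decrease the length of words, so degree \<open>n\<close> only depends on this polynomial.\<close>
  let ?g = "\<Sum>i\<le>n. nc_component i f"
  have "?g \<in> lie_polys"
    using assms(2) by (intro lie_polys_sum) (simp add: lie_series_def)
  then have "nc_component n (nc_der \<psi> ?g) \<in> lie_polys"
    using nc_der_lie_poly[OF assms(1)] by (simp add: lie_series_def)
  moreover have "nc_component n (nc_der \<psi> f) = nc_component n (nc_der \<psi> ?g)"
    by (auto simp: ncps_eq_iff coeff_component coeff_sum intro!: nc_der_coeff_local)
  ultimately show "nc_component n (nc_der \<psi> f) \<in> lie_polys" by simp
qed

section \<open>Words with at most one \<open>x\<^sub>1\<close>\<close>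

text \<open>Taking the coefficients of the powers of one letter is a homomorphism to a commutative algebra,
  so brackets are sent to zero.\<close>
lemma lie_poly_coeff_power:
  assumes "f \<in> lie_polys" "n \<noteq> 1"
  shows "f $$ replicate n i = 0"
  using assms
proof induction
  case (var j)
  then show ?case by (auto simp: nc_var_def coeff_word) (metis length_replicate length_Cons list.size(3) One_nat_def)
next
  case (br f g)
  have "(f * g) $$ replicate n i = (\<Sum>j\<le>n. f $$ replicate j i * g $$ replicate (n - j) i)"
    for f g :: "'a ncps"
    by (auto simp: coeff_mult intro!: sum.cong)
  moreover have "(\<Sum>j\<le>n. f $$ replicate j i * g $$ replicate (n - j) i) =
      (\<Sum>j\<le>n. f $$ replicate (n - j) i * g $$ replicate j i)"
    by (rule sum.reindex_bij_witness[where i = "\<lambda>i. n - i" and j = "\<lambda>i. n - i"]) auto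
  ultimately show ?case
    by (simp add: nc_br_def mult.commute)
qed auto

lemma lie_series_coeff_power:
  assumes "f \<in> lie_series" "f $$ [i] = 0"
  shows "f $$ replicate n i = 0"
proof (cases "n = 1")
  case False
  have "nc_component n f \<in> lie_polys" using assms(1) by (simp add: lie_series_def)
  from lie_poly_coeff_power[OF this False, of i] show ?thesis by (simp add: coeff_component)
qed (use assms in simp)

text \<open>A factorisation of a word with a single \<open>x\<^sub>1\<close> in the last place has a left factor that is a
  power of \<open>x\<^sub>0\<close>, unless the right factor is empty.\<close>
lemma mult_coeff_depth1:
  assumes "\<And>m. f $$ replicate m X0 = 0"
    and "\<And>m. f $$ (replicate m X0 @ [X1]) = 0 \<or> g $$ [] = 0"
  shows "(f * g) $$ (replicate n X0 @ [X1]) = 0"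
  unfolding coeff_mult
proof (rule sum.neutral, rule ballI)
  fix i assume i: "i \<in> {..length (replicate n X0 @ [X1])}"
  show "f $$ take i (replicate n X0 @ [X1]) * g $$ drop i (replicate n X0 @ [X1]) = 0"
  proof (cases "i = Suc n")
    case True
    then show ?thesis using assms(2)[of n] by auto
  next
    case False
    with i have "take i (replicate n X0 @ [X1]) = replicate i X0" by simp
    then show ?thesis using assms(1) by simp
  qed
qed

text \<open>If \<open>x\<^sub>1\<close> occurs in every word of \<open>\<psi>\<close>, then \<open>d\<^sub>\<psi>\<close> replaces an \<open>x\<^sub>1\<close> by \<open>[x\<^sub>1, \<psi>]\<close>, whose words
  contain it at least twice.\<close>
lemma nc_der_coeff_depth1:
  assumes "\<And>m. \<psi> $$ replicate m X0 = 0"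
  shows "nc_der \<psi> f $$ (replicate n X0 @ [X1]) = 0"
proof -
  let ?h = "nc_br (nc_var X1) \<psi>"
  have var: "nc_var X1 $$ replicate m X0 = (0 :: 'a)" for m
    by (cases m) (auto simp: nc_var_def coeff_word)
  have \<psi>_Nil: "\<psi> $$ [] = 0" using assms[of 0] by simp
  have h0: "?h $$ replicate m X0 = 0" for m
  proof -
    have "(f * g) $$ replicate m X0 = 0"
      if "\<And>m. f $$ replicate m X0 = 0" for f g :: "'a ncps"
      unfolding coeff_mult by (rule sum.neutral) (auto simp: that)
    then show ?thesis by (simp add: nc_br_def var assms)
  qed
  have h1: "?h $$ (replicate m X0 @ [X1]) = 0" for m
    unfolding nc_br_def by (simp add: mult_coeff_depth1 var assms \<psi>_Nil)
  have step: "nc_der \<psi> f = nc_var X0 * nc_der \<psi> (nc_dR X0 f) + ?h * nc_dR X1 f +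
      nc_var X1 * nc_der \<psi> (nc_dR X1 f)" for f
    by (subst nc_dR_decomp[of f]) (simp add: nc_der_leibniz)
  have h2: "(?h * g) $$ (replicate m X0 @ [X1]) = 0" for m g
    by (rule mult_coeff_depth1) (use h0 h1 in auto)
  have Nil: "nc_der \<psi> f $$ [] = 0" for f
    by (subst step) (use h0[of 0] in simp)
  show ?thesis
  proof (induction n arbitrary: f)
    case 0
    show ?case
      by (subst step) (use h2[of _ 0] Nil in simp)
  next
    case (Suc n)
    then show ?case
      by (subst step) (use h2[of _ "Suc n"] in simp)
  qed
qed

lemma ihara_bracket_coeff_depth1:
  assumes "\<And>m. \<psi> $$ replicate m X0 = 0" "\<And>m. \<phi> $$ replicate m X0 = 0"
  shows "ihara_bracket \<psi> \<phi> $$ (replicate n X0 @ [X1]) = 0"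
proof -
  have "\<psi> $$ [] = 0" "\<phi> $$ [] = 0" using assms[of 0] by simp_all
  then show ?thesis
    using assms by (simp add: ihara_bracket_def nc_br_def nc_der_coeff_depth1 mult_coeff_depth1)
qed

section \<open>The power series \<open>r\<^sub>\<eta>\<close>\<close>

lemma nc_var_power: "nc_var i ^ n = nc_word (replicate n i)"
  by (induction n) (simp_all add: nc_word_Nil nc_word_Cons)

lemma coeff_r: "nc_r \<eta> (nc_var i) $$ w =
  (if w \<noteq> [] \<and> w = replicate (length w) i then \<eta> $$ (replicate (length w) X0 @ [X1]) else 0)"
proof -
  have *: "w = replicate (Suc l) i \<longleftrightarrow> w \<noteq> [] \<and> w = replicate (length w) i \<and> l = length w - 1" for l
  proof
    assume w: "w = replicate (Suc l) i"
    then have "length w = Suc l" by (simp del: replicate_Suc)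
    with w show "w \<noteq> [] \<and> w = replicate (length w) i \<and> l = length w - 1" by auto
  next
    assume w: "w \<noteq> [] \<and> w = replicate (length w) i \<and> l = length w - 1"
    then have "length w = Suc l" by (cases w) auto
    with w show "w = replicate (Suc l) i" by metis
  qed
  have "nc_r \<eta> (nc_var i) $$ w = (\<Sum>l\<in>{length w - 1}.
      \<eta> $$ (replicate (l + 1) X0 @ [X1]) * nc_word (replicate (l + 1) i) $$ w)"
    unfolding nc_r_def nc_sum_def nc_var_power coeff_Abs_ncps coeff_scale
    by (rule Sum_any.expand_superset) (auto simp: coeff_word)
  then show ?thesis
    by (auto simp: coeff_word * simp del: replicate_Suc)
qed

lemma nc_r_over: "nc_r \<eta> (nc_var i) \<in> nc_over {i}"
proof -
  have "set w \<subseteq> {i}" if "nc_r \<eta> (nc_var i) $$ w \<noteq> 0" for w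
  proof -
    have "w = replicate (length w) i" using that by (simp add: coeff_r split: if_splits)
    then show ?thesis by (metis set_replicate_conv_if empty_subsetI order_refl)
  qed
  then show ?thesis by (simp add: nc_over_def)
qed

lemma nc_r_swap: "nc_swap (nc_r \<eta> (nc_var i)) = nc_r \<eta> (nc_var (other i))"
proof (rule ncps_eqI)
  fix w
  have "map other w = replicate (length w) i \<longleftrightarrow> w = replicate (length w) (other i)"
    by (metis map_other_other map_replicate other_other)
  then show "nc_swap (nc_r \<eta> (nc_var i)) $$ w = nc_r \<eta> (nc_var (other i)) $$ w"
    by (simp add: coeff_swap coeff_r)
qed

lemma over_singleton_commutes:
  assumes "f \<in> nc_over {i}"
  shows "nc_br f (nc_var i) = 0"
proof -
  \<comment> \<open>\<open>[x\<^sub>i, -]\<close> and the zero derivation agree on \<open>x\<^sub>i\<close>.\<close>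
  have "nc_br (nc_var i) f = (\<lambda>g. nc_scale 0 (nc_br (nc_var i) g)) f"
    by (rule nc_derivation_eqI[OF nc_derivation_br nc_derivation_scaled[OF nc_derivation_br] _ assms])
      (simp add: nc_br_def)
  then show ?thesis by (simp add: nc_br_def)
qed

lemma nc_der_over_X1:
  assumes "f \<in> nc_over {X1}"
  shows "nc_der \<psi> f = nc_br f \<psi>"
proof -
  have "nc_der \<psi> f = nc_scale (-1) (nc_br \<psi> f)"
    by (rule nc_derivation_eqI[OF nc_derivation_der nc_derivation_scaled[OF nc_derivation_br] _ assms])
      (simp add: nc_br_def)
  then show ?thesis by (simp add: nc_br_def)
qed

lemma nc_der_over_X0:
  assumes "f \<in> nc_over {X0}"
  shows "nc_der \<psi> f = 0"
proof -
  have "nc_der \<psi> f = nc_scale 0 (nc_der \<psi> f)"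
    by (rule nc_derivation_eqI[OF nc_derivation_der nc_derivation_scaled[OF nc_derivation_der] _ assms])
      simp
  then show ?thesis by simp
qed

text \<open>\<open>[x\<^sub>1, a - b] = [x\<^sub>1, a]\<close> as \<open>b\<close> commutes with \<open>x\<^sub>1\<close>, and \<open>a\<close> commutes with \<open>x\<^sub>0\<close>; thus
  \<open>d\<close> and the inner derivation \<open>[-, a]\<close> have the same values on the letters.\<close>
lemma nc_der_index_diff_over:
  assumes "a \<in> nc_over {X0}" "b \<in> nc_over {X1}"
  shows "nc_der (a - b) f = nc_br f a"
proof -
  have "nc_der (a - b) f = nc_scale (-1) (nc_br a f)"
  proof (rule nc_derivation_ext[OF nc_derivation_der nc_derivation_scaled[OF nc_derivation_br]])
    show "nc_der (a - b) (nc_var i) = nc_scale (-1) (nc_br a (nc_var i))" for i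
      using over_singleton_commutes[OF assms(1)] over_singleton_commutes[OF assms(2)]
      by (cases i) (simp_all add: nc_br_def algebra_simps)
  qed
  then show ?thesis by (simp add: nc_br_def)
qed

section \<open>The reduced coaction of an Ihara bracket\<close>

text \<open>Signed insertion of \<open>\<psi>\<close> into the gaps of words that stand behind a letter \<open>x\<^sub>i\<close>, including the
  gap between \<open>x\<^sub>i\<close> and the word: if \<open>x\<^sub>i = x\<^sub>1\<close>, the summand \<open>\<psi> f\<close> is the contribution
  \<open>x\<^sub>1 \<psi> f\<close> of the letter \<open>x\<^sub>1\<close> in front of \<open>f\<close>. It cancels the \<open>- \<psi> x\<^sub>1\<close> of a following
  \<open>x\<^sub>1\<close>.\<close>
definition ins_after :: "'k::field ncps \<Rightarrow> letter \<Rightarrow> 'k ncps \<Rightarrow> 'k ncps" where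
  "ins_after \<psi> i f = nc_der \<psi> f + (if i = X1 then \<psi> * f else 0)"

lemma ins_after_simps [simp]:
  "ins_after \<psi> i (f + g) = ins_after \<psi> i f + ins_after \<psi> i g"
  "ins_after \<psi> i (nc_scale c f) = nc_scale c (ins_after \<psi> i f)"
  "ins_after \<psi> i 0 = 0"
  by (simp_all add: ins_after_def algebra_simps ncps.scale_right_distrib)

text \<open>The summand beside the recursive one is the insertion into the gap \<open>x\<^sub>i|x\<^sub>j\<close>.\<close>
lemma ins_after_var_mult:
  "ins_after \<psi> i (nc_var j * f) = nc_var j * ins_after \<psi> j f +
    (if i = j then 0 else if i = X1 then \<psi> * (nc_var j * f) else - (\<psi> * (nc_var j * f)))"
  by (cases i; cases j)
    (simp_all add: ins_after_def nc_der_leibniz nc_br_def algebra_simps)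

text \<open>Contraction commutes with insertion, except that the contractions that involve an inserted \<open>\<psi>\<close>
  amount to the insertion of \<open>\<rho>\<close>. The assumption says this for a single gap, of either sign. A gap
  between equal letters carries no insertion, and contracting it leaves all other gaps as they are.
  The final \<open>x\<^sub>0\<close> is a right wall: without it \<open>d\<^sub>\<psi>\<close> would also insert \<open>\<psi>\<close> at the open end, where
  the assumption does not determine its contractions.\<close>
lemma mu_after_ins_after:
  assumes "\<And>i j. i \<noteq> j \<Longrightarrow> nc_dR i \<psi> + nc_mu \<psi> + nc_dL j \<psi> = \<rho>"
  shows "mu_after i (ins_after \<psi> i (f * nc_var X0)) =
    ins_after \<rho> i (f * nc_var X0) + ins_after \<psi> i (mu_after i (f * nc_var X0))"
proof -
  define \<Theta> where "\<Theta> i g = mu_after i (ins_after \<psi> i g) -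
    ins_after \<rho> i g - ins_after \<psi> i (mu_after i g)" for i g
  have add: "\<Theta> i (f + g) = \<Theta> i f + \<Theta> i g" and scale: "\<Theta> i (nc_scale c f) = nc_scale c (\<Theta> i f)"
    for i f g c
    by (simp_all add: \<Theta>_def algebra_simps ncps.scale_right_diff_distrib)
  have var: "\<Theta> i (nc_var j * g) = nc_var j * \<Theta> j g" for i j g
    using assms[of i j]
    by (auto simp: \<Theta>_def ins_after_var_mult mu_after_var_mult mu_after_mult_var_mult algebra_simps)
  have base: "\<Theta> i (nc_var X0) = 0" for i
    using var[of i X0 1] by (simp add: \<Theta>_def ins_after_def)
  have "\<Theta> i (f * nc_var X0) = 0"
  proof (rule vanishes_by_peeling[where P = UNIV and \<Delta> = "\<lambda>i f. \<Theta> i (f * nc_var X0)"])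
    show "\<Theta> i (g * nc_var X0) = nc_var X0 * \<Theta> X0 (nc_dR X0 g * nc_var X0) +
        nc_var X1 * \<Theta> X1 (nc_dR X1 g * nc_var X0)" for i g
      by (subst nc_dR_decomp[of g])
        (simp only: distrib_right nc_scale_mult_left mult_1_left mult.assoc add scale var base
          ncps.scale_zero_right add_0)
  qed simp_all
  then show ?thesis by (simp add: \<Theta>_def algebra_simps)
qed


text \<open>The left-hand side of the reduced coaction equation: the contraction of \<open>x\<^sub>1 f x\<^sub>0\<close>, stripped of
  its first and last letter.\<close>
definition between_walls :: "'k::field ncps \<Rightarrow> 'k ncps" where
  "between_walls f = nc_dR X1 f + nc_mu f + nc_dL X0 f"

lemma between_walls_simps:
  "between_walls (f + g) = between_walls f + between_walls g"
  "between_walls (f - g) = between_walls f - between_walls g"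
  "between_walls (nc_scale c f) = nc_scale c (between_walls f)"
  "between_walls 0 = 0"
  by (simp_all add: between_walls_def algebra_simps ncps.scale_right_distrib)
    (simp add: nc_dL_def ncps_eq_iff)

lemma mu_after_mult_X0: "mu_after X1 (f * nc_var X0) = between_walls f * nc_var X0"
  using mu_after_mult_var_mult[of X1 X0 f 1] by (simp add: between_walls_def)

text \<open>This is \<open>mu_after_ins_after\<close> behind the wall \<open>x\<^sub>1\<close>; the right wall \<open>x\<^sub>0\<close> is killed by every
  derivation \<open>d\<close> and can be cancelled.\<close>
lemma between_walls_insertion:
  assumes "\<And>i j. i \<noteq> j \<Longrightarrow> nc_dR i \<psi> + nc_mu \<psi> + nc_dL j \<psi> = \<rho>"
  shows "between_walls (nc_der \<psi> f + \<psi> * f) = nc_der \<rho> f + \<rho> * f +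
    nc_der \<psi> (between_walls f) + \<psi> * between_walls f"
proof -
  have ins: "ins_after \<phi> X1 (g * nc_var X0) = (nc_der \<phi> g + \<phi> * g) * nc_var X0" for \<phi> g :: "'a ncps"
    by (simp add: ins_after_def nc_der_leibniz algebra_simps)
  have "mu_after X1 (ins_after \<psi> X1 (f * nc_var X0)) =
      ins_after \<rho> X1 (f * nc_var X0) + ins_after \<psi> X1 (mu_after X1 (f * nc_var X0))"
    by (rule mu_after_ins_after) (rule assms)
  then have "between_walls (nc_der \<psi> f + \<psi> * f) * nc_var X0 = (nc_der \<rho> f + \<rho> * f +
      nc_der \<psi> (between_walls f) + \<psi> * between_walls f) * nc_var X0"
    unfolding ins mu_after_mult_X0 by (simp only: distrib_right add.assoc)
  then show ?thesis by (rule nc_var_mult_right_cancel)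
qed

definition nc_rho :: "'k::field ncps \<Rightarrow> 'k ncps" where
  "nc_rho \<eta> = nc_r \<eta> (nc_var X0) - nc_r \<eta> (nc_var X1)"

lemma rc0_bar_iff: "\<eta> \<in> rc0_bar \<longleftrightarrow> \<eta> \<in> lie_series \<and> \<eta> $$ [X0] = 0 \<and> \<eta> $$ [X1] = 0 \<and>
    nc_swap \<eta> = - \<eta> \<and> between_walls \<eta> = nc_rho \<eta>"
proof -
  have "\<eta> = - nc_swap \<eta> \<longleftrightarrow> nc_swap \<eta> = - \<eta>" by (metis minus_minus)
  then show ?thesis
    by (simp add: rc0_bar_def nc_subst_swap between_walls_def nc_rho_def)
qed

text \<open>For the walls in the opposite order, apply the exchange of letters to the reduced coaction
  equation: the left-hand side becomes minus the one for the opposite walls, and \<open>\<rho>\<close> becomes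
  \<open>- \<rho>\<close>.\<close>
lemma rc0_bar_walls:
  assumes "\<eta> \<in> rc0_bar" "i \<noteq> j"
  shows "nc_dR i \<eta> + nc_mu \<eta> + nc_dL j \<eta> = nc_rho \<eta>"
proof -
  have swap: "nc_swap \<eta> = - \<eta>" and walls: "nc_dR X1 \<eta> + nc_mu \<eta> + nc_dL X0 \<eta> = nc_rho \<eta>"
    using assms(1) by (simp_all add: rc0_bar_iff between_walls_def)
  have "nc_swap (nc_dR X1 \<eta> + nc_mu \<eta> + nc_dL X0 \<eta>) =
      - (nc_dR X0 \<eta> + nc_mu \<eta> + nc_dL X1 \<eta>)"
    by (simp add: nc_swap_dR nc_swap_dL nc_swap_mu swap)
  moreover have "nc_swap (nc_rho \<eta>) = - nc_rho \<eta>"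
    by (simp add: nc_rho_def nc_r_swap)
  ultimately have "nc_dR X0 \<eta> + nc_mu \<eta> + nc_dL X1 \<eta> = nc_rho \<eta>"
    using walls by (metis neg_equal_iff_equal)
  with walls assms(2) show ?thesis by (cases i; cases j) auto
qed

text \<open>The right-hand side is symmetric in \<open>\<psi>\<close> and \<open>\<phi>\<close>. The four summands \<open>d\<^sub>\<rho>(\<psi>)\<close>, \<open>\<rho>\<psi>\<close>,
  \<open>d\<^sub>\<phi>(\<rho>')\<close>, \<open>\<phi>\<rho>'\<close>, with \<open>\<rho>\<close> and \<open>\<rho>'\<close> belonging to \<open>\<phi>\<close> and \<open>\<psi>\<close>, are asymmetric
  individually, but the inner derivations \<open>d\<^sub>\<rho>(\<psi>) = [\<psi>, r\<^sub>\<phi>(x\<^sub>0)]\<close> and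
  \<open>d\<^sub>\<phi>(\<rho>') = [\<phi>, r\<^sub>\<psi>(x\<^sub>1)]\<close> move the offending factors to the other side.\<close>
lemma between_walls_insertion_rc0:
  assumes "\<psi> \<in> rc0_bar" "\<phi> \<in> rc0_bar"
  shows "between_walls (nc_der \<phi> \<psi> + \<phi> * \<psi>) =
    \<psi> * nc_r \<phi> (nc_var X0) + \<phi> * nc_r \<psi> (nc_var X0)
    - nc_r \<phi> (nc_var X1) * \<psi> - nc_r \<psi> (nc_var X1) * \<phi>"
proof -
  have "between_walls \<psi> = nc_rho \<psi>" using assms(1) by (simp add: rc0_bar_iff)
  then have "between_walls (nc_der \<phi> \<psi> + \<phi> * \<psi>) = nc_der (nc_rho \<phi>) \<psi> + nc_rho \<phi> * \<psi> +
      nc_der \<phi> (nc_rho \<psi>) + \<phi> * nc_rho \<psi>"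
    using between_walls_insertion[OF rc0_bar_walls[OF assms(2)], of \<psi>] by simp
  then show ?thesis
    by (simp add: nc_rho_def nc_der_index_diff_over[OF nc_r_over nc_r_over]
        nc_der_over_X0[OF nc_r_over] nc_der_over_X1[OF nc_r_over])
      (simp add: nc_br_def algebra_simps)
qed

text \<open>Both sides of the reduced coaction equation vanish for the bracket: the left one by
  antisymmetrising a symmetric expression, the right one for lack of words with a single \<open>x\<^sub>1\<close>.\<close>
lemma ihara_bracket_rc0:
  assumes \<psi>: "\<psi> \<in> rc0_bar" and \<phi>: "\<phi> \<in> rc0_bar"
  shows "ihara_bracket \<psi> \<phi> \<in> rc0_bar"
  unfolding rc0_bar_iff
proof (intro conjI)
  note \<psi>' = \<psi>[unfolded rc0_bar_iff] and \<phi>' = \<phi>[unfolded rc0_bar_iff]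
  let ?b = "ihara_bracket \<psi> \<phi>"
  show "?b \<in> lie_series"
    unfolding ihara_bracket_def using \<psi>' \<phi>'
    by (intro lie_series_diff lie_series_der lie_series_br) auto
  show swap: "nc_swap ?b = - ?b"
    using \<psi>' \<phi>' by (simp add: nc_swap_ihara_bracket)
  have depth1: "?b $$ (replicate n X0 @ [X1]) = 0" for n
    using \<psi>' \<phi>' by (intro ihara_bracket_coeff_depth1 lie_series_coeff_power) auto
  show X1: "?b $$ [X1] = 0" using depth1[of 0] by simp
  \<comment> \<open>The coefficient of \<open>x\<^sub>0\<close> follows from that of \<open>x\<^sub>1\<close> by skew-symmetry.\<close>
  have "nc_swap ?b $$ [X1] = - ?b $$ [X1]" by (simp add: swap)
  then show "?b $$ [X0] = 0" by (simp add: coeff_swap X1)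
  have "nc_rho ?b = 0"
    unfolding nc_rho_def nc_r_def depth1 by (simp add: nc_sum_def ncps_eq_iff)
  moreover have "between_walls ?b = 0"
  proof -
    have "?b = (nc_der \<phi> \<psi> + \<phi> * \<psi>) - (nc_der \<psi> \<phi> + \<psi> * \<phi>)"
      by (simp add: ihara_bracket_def nc_br_def algebra_simps)
    then have "between_walls ?b =
        between_walls (nc_der \<phi> \<psi> + \<phi> * \<psi>) - between_walls (nc_der \<psi> \<phi> + \<psi> * \<phi>)"
      by (metis between_walls_simps(2))
    then show ?thesis
      unfolding between_walls_insertion_rc0[OF \<psi> \<phi>] between_walls_insertion_rc0[OF \<phi> \<psi>]
      by (simp add: algebra_simps)
  qed
  ultimately show "between_walls ?b = nc_rho ?b" by simp
qed

section \<open>The Lie algebra structure\<close>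

lemma subspace_rc0_bar: "ncps.subspace rc0_bar"
proof -
  have rho: "nc_rho (f + g) = nc_rho f + nc_rho g" "nc_rho (nc_scale c f) = nc_scale c (nc_rho f)"
    "nc_rho 0 = 0" for f g :: "'a ncps" and c
    by (simp_all add: ncps_eq_iff nc_rho_def coeff_r algebra_simps)
  show ?thesis
    by (rule ncps.subspaceI)
      (auto simp: rc0_bar_iff rho between_walls_simps lie_series_zero lie_series_add lie_series_scale)
qed

theorem theorem1p4:
  shows "lie_algebra_on nc_scale (rc0_bar :: 'k::field_char_0 ncps set) ihara_bracket \<and>
    (\<forall>\<psi>1 \<in> rc0_bar. \<forall>\<psi>2 \<in> rc0_bar. ihara_bracket \<psi>1 \<psi>2 \<in> (rc0_bar :: 'k ncps set))"
proof
  show "lie_algebra_on nc_scale (rc0_bar :: 'k ncps set) ihara_bracket"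
  proof (intro lie_algebra_on.intro lie_algebra_on_axioms.intro)
    show "ihara_bracket x x = 0" for x :: "'k ncps"
      by (simp add: ihara_bracket_def nc_br_def)
  qed (simp_all add: ncps.vector_space_axioms subspace_rc0_bar ihara_bracket_rc0
      ihara_bracket_add_left ihara_bracket_add_right ihara_bracket_scale_left
      ihara_bracket_scale_right ihara_bracket_jacobi)
qed (simp add: ihara_bracket_rc0)

end
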